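(* Let $(G_\ell)_{\ell\ge 0}$ be a sequence of real-valued random variables, and write $Y_\ell = |G_\ell - \mathrm{E}[G_\ell]|$. Suppose there are constants $\beta>1$ and $C_1, C_2, q_3, \delta, \tau > 0$ such that $$C_1\,\beta^{-q_3\ell} \le \mathrm{E}[Y_\ell^2] \quad\text{and}\quad \mathrm{E}[Y_\ell^{2+\delta}] \le C_2\,\beta^{-\tau\ell}\qquad\text{for all } \ell\ge 0.$$ Let $q_2>0$, let $\{H_\ell\}_{\ell\ge 0}$ be a strictly positive sequence, and let $c>0$ and $C\in\mathbb{R}$ be constants. For each tolerance $\mathrm{TOL}>0$, let the number of levels $L=L(\mathrm{TOL})$ be a non-negative integer with $$L \le \max\left(0,\ \frac{c\,\log(\mathrm{TOL}^{-1})}{\log\beta} + C\right),$$ and let the numbers of samples $M_\ell = M_\ell(\mathrm{TOL})$ be positive integers with $$M_\ell \ \ge\ \beta^{-q_2\ell}\,\mathrm{TOL}^{-2}\,H_\ell^{-1}\left(\sum_{k=0}^{L} H_k\right)\qquad\text{for all } 0\le \ell\le L.$$ Let $$\mathcal{A} = \mathcal{A}(\mathrm{TOL}) = \sum_{\ell=0}^{L}\sum_{m=1}^{M_\ell}\frac{G_\ell(\omega_{\ell,m})}{M_\ell}$$ be the corresponding multilevel Monte Carlo estimator, where for each $\ell$ the $G_\ell(\omega_{\ell,m})$, $1\le m\le M_\ell$, are i.i.d. samples of $G_\ell$, and the samples are also independent across different levels $\ell$. Put $$p = (1+\delta/2)\,q_3 + (\delta/2)\,q_2 - \tau.$$ If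 either $p<0$, or $p>0$ and $c<\delta/p$, then for every $z\in\mathbb{R}$ $$\lim_{\mathrm{TOL}\to 0} \mathrm{P}\left[\frac{\mathcal{A}-\mathrm{E}[\mathcal{A}]}{\sqrt{\mathrm{Var}[\mathcal{A}]}}\le z\right] = \Phi(z).$$
   Context: $\Phi$ denotes the cumulative distribution function of a standard normal random variable. $\mathrm{E}$, $\mathrm{Var}$ and $\mathrm{P}$ denote expectation, variance and probability. The notation $G_\ell(\omega_{\ell,m})$ stands for the $m$-th sample of the random variable $G_\ell$; all the samples $G_\ell(\omega_{\ell,m})$, $0\le\ell\le L$, $1\le m\le M_\ell$, are mutually independent, and $G_\ell(\omega_{\ell,m})$ has the same distribution as $G_\ell$. The constants $\beta, C_1, C_2, q_2, q_3, \delta, \tau, c, C$ and the sequence $\{H_\ell\}$ do not depend on $\mathrm{TOL}$, whereas $L$ and $M_\ell$ may depend on $\mathrm{TOL}$. *)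

theory Defs
  imports "HOL-Probability.Probability"
begin

definition abs_deviation :: "'a measure \<Rightarrow> ('a \<Rightarrow> real) \<Rightarrow> 'a \<Rightarrow> real" where
  "abs_deviation P X = (\<lambda>\<omega>. \<bar>X \<omega> - prob_space.expectation P X\<bar>)"

(* X l m plays the role of the m-th sample of G_l; the samples of a level are numbered from 1. *)
definition mlmc_estimator ::
  "(nat \<Rightarrow> nat \<Rightarrow> 'b \<Rightarrow> real) \<Rightarrow> nat \<Rightarrow> (nat \<Rightarrow> nat) \<Rightarrow> 'b \<Rightarrow> real" where
  "mlmc_estimator X L M = (\<lambda>\<omega>. \<Sum>l=0..L. \<Sum>m=1..M l. X l m \<omega> / real (M l))"

(* The indices (l, m) that occur in the estimator. Equality in law with G_l for every index of
   level l makes the samples of a level identically distributed; independence is over all indices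
   jointly, i.e. both within a level and across levels. *)
definition mlmc_samples ::
  "'a measure \<Rightarrow> (nat \<Rightarrow> 'a \<Rightarrow> real) \<Rightarrow> 'b measure \<Rightarrow> (nat \<Rightarrow> nat \<Rightarrow> 'b \<Rightarrow> real)
     \<Rightarrow> nat \<Rightarrow> (nat \<Rightarrow> nat) \<Rightarrow> bool" where
  "mlmc_samples P G Q X L M \<longleftrightarrow>
     prob_space.indep_vars Q (\<lambda>_. borel) (\<lambda>(l, m). X l m) (SIGMA l:{0..L}. {1..M l}) \<and>
     (\<forall>l\<in>{0..L}. \<forall>m\<in>{1..M l}. distr Q borel (X l m) = distr P borel (G l))"

end

theory Submission
  imports Defs "HOL-Real_Asymp.Real_Asymp"
begin

text \<open>
  The estimator is a sum of independent centred terms \<open>(X l m - E[G l]) / M l\<close>, so it suffices to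
  verify Lyapunov's condition. Bounding \<open>Var[A]\<close> below by its level-\<open>l\<close> contribution
  \<open>Var[G l] / M l\<close> alone and using \<open>M l \<ge> \<beta> powr (- q\<^sub>2 * l) * TOL powr (- 2)\<close>, the Lyapunov ratio of
  level \<open>l\<close> is at most a constant times \<open>TOL powr \<delta> * \<beta> powr (p * l)\<close>. Summed over the levels this is
  of order \<open>TOL powr \<delta>\<close> for \<open>p < 0\<close> and at most of order \<open>TOL powr \<delta> + TOL powr (\<delta> - c * p)\<close> for
  \<open>p > 0\<close>. Lyapunov's theorem itself follows from comparing characteristic functions factor by
  factor, splitting at \<open>\<bar>x\<bar> = \<epsilon>\<close>: every \<open>\<epsilon> > 0\<close> yields a bound in which only terms vanishing with
  \<open>\<epsilon>\<close> survive in the limit.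
\<close>

subsection \<open>Lyapunov's central limit theorem\<close>

text \<open>Beyond the truncation level the factor
  \<open>(\<bar>x\<bar> / \<epsilon>) powr \<delta>\<close> is at least 1, so multiplying the square
  by it only helps.\<close>

lemma square_le_powr:
  fixes x \<delta> \<epsilon> :: real
  assumes "\<delta> \<ge> 0" "\<epsilon> > 0" "\<epsilon> < \<bar>x\<bar>"
  shows "x\<^sup>2 \<le> \<bar>x\<bar> powr (2 + \<delta>) / \<epsilon> powr \<delta>"
proof -
  have "x\<^sup>2 * \<epsilon> powr \<delta> \<le> x\<^sup>2 * \<bar>x\<bar> powr \<delta>"
    using assms by (intro mult_left_mono powr_mono2) auto
  also have "\<dots> = \<bar>x\<bar> powr (2 + \<delta>)"
    using assms by (simp add: powr_add)
  finally show ?thesis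
    using assms by (simp add: field_simps)
qed

lemma square_le_powr_split:
  fixes x \<delta> \<epsilon> :: real
  assumes "\<delta> \<ge> 0" "\<epsilon> > 0"
  shows "x\<^sup>2 \<le> \<epsilon>\<^sup>2 + \<bar>x\<bar> powr (2 + \<delta>) / \<epsilon> powr \<delta>"
proof (cases "\<bar>x\<bar> \<le> \<epsilon>")
  case True
  then have "x\<^sup>2 \<le> \<epsilon>\<^sup>2"
    using abs_le_square_iff[of x \<epsilon>] assms by simp
  then show ?thesis by (simp add: add_increasing2)
next
  case False
  then show ?thesis
    using square_le_powr[OF assms, of x] by (simp add: add_increasing)
qed

text \<open>The minimum is the integrand in the third-order remainder of a characteristic function.
  For \<open>\<bar>x\<bar> \<le> \<epsilon>\<close> the cubic branch gives off one factor
  \<epsilon>; for larger \<open>\<bar>x\<bar>\<close> the quadratic branch is absorbed by the higher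
  moment.\<close>

lemma min_square_cube_le:
  fixes x t \<delta> \<epsilon> :: real
  assumes "\<delta> \<ge> 0" "\<epsilon> > 0"
  shows "min (6 * x\<^sup>2) (\<bar>t\<bar> * \<bar>x\<bar> ^ 3) \<le> \<epsilon> * \<bar>t\<bar> * x\<^sup>2 + 6 * (\<bar>x\<bar> powr (2 + \<delta>) / \<epsilon> powr \<delta>)"
proof (cases "\<bar>x\<bar> \<le> \<epsilon>")
  case True
  have "min (6 * x\<^sup>2) (\<bar>t\<bar> * \<bar>x\<bar> ^ 3) \<le> \<bar>x\<bar> * (\<bar>t\<bar> * x\<^sup>2)"
    by (rule min.coboundedI2) (simp add: power3_eq_cube power2_eq_square)
  also have "\<dots> \<le> \<epsilon> * (\<bar>t\<bar> * x\<^sup>2)"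
    using True by (intro mult_right_mono) auto
  also have "\<dots> \<le> \<epsilon> * \<bar>t\<bar> * x\<^sup>2 + 6 * (\<bar>x\<bar> powr (2 + \<delta>) / \<epsilon> powr \<delta>)"
    by simp
  finally show ?thesis .
next
  case False
  then have "6 * x\<^sup>2 \<le> \<epsilon> * \<bar>t\<bar> * x\<^sup>2 + 6 * (\<bar>x\<bar> powr (2 + \<delta>) / \<epsilon> powr \<delta>)"
    using square_le_powr[OF assms, of x] assms by (intro add_increasing) auto
  then show ?thesis by simp
qed

text \<open>Taylor expansion with Lagrange remainder: the intermediate point \<open>s\<close> is
  negative, so the factor \<open>exp s\<close> is below 1.\<close>

lemma exp_minus_quadratic_bound:
  fixes u :: real
  assumes "u \<ge> 0"
  shows "\<bar>exp (- u) - (1 - u)\<bar> \<le> u\<^sup>2 / 2"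
proof (cases "u = 0")
  case False
  obtain s where s: "s < 0" "exp (- u) = (\<Sum>m<2. (- u) ^ m / fact m) + exp s / fact 2 * (- u) ^ 2"
    using Maclaurin_minus[of "-u" 2 "\<lambda>_. exp" exp] False assms
    by (auto intro!: derivative_eq_intros)
  have "exp s * u\<^sup>2 \<le> 1 * u\<^sup>2"
    using s by (intro mult_right_mono) auto
  with s show ?thesis by (simp add: numeral_2_eq_2)
qed simp

section \<open>Characteristic functions compared with normal ones\<close>

lemma (in prob_space) integrable_square_of_powr:
  fixes X :: "'a \<Rightarrow> real"
  assumes [measurable]: "X \<in> borel_measurable M"
    and mom: "integrable M (\<lambda>x. \<bar>X x\<bar> powr (2 + \<delta>))" and \<delta>: "\<delta> > 0"
  shows "integrable M (\<lambda>x. (X x)\<^sup>2)"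
proof (rule Bochner_Integration.integrable_bound)
  show "integrable M (\<lambda>x. 1 + \<bar>X x\<bar> powr (2 + \<delta>))"
    using mom by simp
  show "AE x in M. norm ((X x)\<^sup>2) \<le> norm (1 + \<bar>X x\<bar> powr (2 + \<delta>))"
    using square_le_powr_split[of \<delta> 1] \<delta> by (auto intro!: AE_I2)
qed simp

text \<open>Both functions of \<open>t\<close> are close to the same quadratic
  \<open>1 - t\<^sup>2 * v / 2\<close>: the characteristic function by its third-order expansion,
  the exponential by Taylor. The second claim makes single variances small, which later controls the
  sum of their squares.\<close>

lemma (in prob_space) char_normal_bound:
  fixes X :: "'a \<Rightarrow> real"
  assumes [measurable]: "X \<in> borel_measurable M"
    and mean: "expectation X = 0"
    and mom: "integrable M (\<lambda>x. \<bar>X x\<bar> powr (2 + \<delta>))"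
    and \<delta>: "\<delta> > 0" and \<epsilon>: "\<epsilon> > 0"
  defines "v \<equiv> expectation (\<lambda>x. (X x)\<^sup>2)"
    and "K \<equiv> expectation (\<lambda>x. \<bar>X x\<bar> powr (2 + \<delta>)) / \<epsilon> powr \<delta>"
  shows "cmod (char (distr M borel X) t - exp (- (t\<^sup>2 * v / 2)))
    \<le> t\<^sup>2 / 6 * (\<epsilon> * \<bar>t\<bar> * v + 6 * K) + (t\<^sup>2 * v)\<^sup>2 / 8"
    and "v \<le> \<epsilon>\<^sup>2 + K"
proof -
  note sq = integrable_square_of_powr[OF assms(1) mom \<delta>]
  have int: "integrable M X"
    by (rule square_integrable_imp_integrable[OF assms(1) sq])
  have "expectation (\<lambda>x. min (6 * (X x)\<^sup>2) (\<bar>t\<bar> * \<bar>X x\<bar> ^ 3))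
      \<le> expectation (\<lambda>x. \<epsilon> * \<bar>t\<bar> * (X x)\<^sup>2 + 6 * (\<bar>X x\<bar> powr (2 + \<delta>) / \<epsilon> powr \<delta>))"
  proof (rule integral_mono)
    show "integrable M (\<lambda>x. min (6 * (X x)\<^sup>2) (\<bar>t\<bar> * \<bar>X x\<bar> ^ 3))"
      by (rule Bochner_Integration.integrable_bound[where f="\<lambda>x. 6 * (X x)\<^sup>2"]) (use sq in auto)
  qed (use sq mom min_square_cube_le[OF less_imp_le[OF \<delta>] \<epsilon>] in auto)
  also have "\<dots> = \<epsilon> * \<bar>t\<bar> * v + 6 * K"
    using sq mom by (simp add: v_def K_def)
  finally have *: "expectation (\<lambda>x. min (6 * (X x)\<^sup>2) (\<bar>t\<bar> * \<bar>X x\<bar> ^ 3)) \<le> \<epsilon> * \<bar>t\<bar> * v + 6 * K" .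
  have "cmod (char (distr M borel X) t - (1 - t\<^sup>2 * v / 2))
      \<le> t\<^sup>2 / 6 * expectation (\<lambda>x. min (6 * (X x)\<^sup>2) (\<bar>t\<bar> * \<bar>X x\<bar> ^ 3))"
    using char_approx3'[OF assms(1) int sq mean _ refl, of v t] mean by (simp add: v_def)
  also have "\<dots> \<le> t\<^sup>2 / 6 * (\<epsilon> * \<bar>t\<bar> * v + 6 * K)"
    using * by (intro mult_left_mono) auto
  finally have 1: "cmod (char (distr M borel X) t - (1 - t\<^sup>2 * v / 2)) \<le> t\<^sup>2 / 6 * (\<epsilon> * \<bar>t\<bar> * v + 6 * K)" .
  have "v \<ge> 0" by (simp add: v_def)
  then have "\<bar>exp (- (t\<^sup>2 * v / 2)) - (1 - t\<^sup>2 * v / 2)\<bar> \<le> (t\<^sup>2 * v / 2)\<^sup>2 / 2"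
    by (intro exp_minus_quadratic_bound) auto
  also have "\<dots> = (t\<^sup>2 * v)\<^sup>2 / 8" by (simp add: power2_eq_square)
  finally have "cmod (complex_of_real (exp (- (t\<^sup>2 * v / 2)) - (1 - t\<^sup>2 * v / 2))) \<le> (t\<^sup>2 * v)\<^sup>2 / 8"
    unfolding norm_of_real .
  then have 2: "cmod (exp (- (t\<^sup>2 * v / 2)) - (1 - t\<^sup>2 * v / 2)) \<le> (t\<^sup>2 * v)\<^sup>2 / 8"
    by simp
  show "cmod (char (distr M borel X) t - exp (- (t\<^sup>2 * v / 2)))
    \<le> t\<^sup>2 / 6 * (\<epsilon> * \<bar>t\<bar> * v + 6 * K) + (t\<^sup>2 * v)\<^sup>2 / 8"
    using 1 2 by (intro norm_diff_triangle_le[OF 1]) (simp add: norm_minus_commute)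
  have "v \<le> expectation (\<lambda>x. \<epsilon>\<^sup>2 + \<bar>X x\<bar> powr (2 + \<delta>) / \<epsilon> powr \<delta>)"
    unfolding v_def using sq mom square_le_powr_split[OF less_imp_le[OF \<delta>] \<epsilon>] by (intro integral_mono) auto
  then show "v \<le> \<epsilon>\<^sup>2 + K"
    using mom by (simp add: K_def prob_space)
qed

text \<open>By independence the left function is a product, and so is the normal one, because the
  variances add up to 1. All factors have modulus at most 1, so the difference of the products is at
  most the sum of the factorwise differences.\<close>

lemma (in prob_space) char_sum_normal_bound:
  fixes X :: "'i \<Rightarrow> 'a \<Rightarrow> real"
  assumes I: "finite I" and indep: "indep_vars (\<lambda>_. borel) X I"
    and mean: "\<And>i. i \<in> I \<Longrightarrow> expectation (X i) = 0"
    and mom: "\<And>i. i \<in> I \<Longrightarrow> integrable M (\<lambda>x. \<bar>X i x\<bar> powr (2 + \<delta>))"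
    and var: "(\<Sum>i\<in>I. expectation (\<lambda>x. (X i x)\<^sup>2)) = 1"
    and \<delta>: "\<delta> > 0" and \<epsilon>: "\<epsilon> > 0"
  defines "K \<equiv> (\<Sum>i\<in>I. expectation (\<lambda>x. \<bar>X i x\<bar> powr (2 + \<delta>))) / \<epsilon> powr \<delta>"
  shows "cmod (char (distr M borel (\<lambda>x. \<Sum>i\<in>I. X i x)) t - exp (- (t\<^sup>2 / 2)))
    \<le> t\<^sup>2 / 6 * (\<epsilon> * \<bar>t\<bar> + 6 * K) + t ^ 4 / 8 * (\<epsilon>\<^sup>2 + K)"
proof -
  define v where "v i = expectation (\<lambda>x. (X i x)\<^sup>2)" for i
  define k where "k i = expectation (\<lambda>x. \<bar>X i x\<bar> powr (2 + \<delta>)) / \<epsilon> powr \<delta>" for i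
  have rv [measurable]: "X i \<in> borel_measurable M" if "i \<in> I" for i
    using indep that by (auto simp: indep_vars_def2)
  have v0: "v i \<ge> 0" and k0: "k i \<ge> 0" for i
    by (simp_all add: v_def k_def)
  have K: "(\<Sum>i\<in>I. k i) = K" by (simp add: K_def k_def sum_divide_distrib)
  have v1: "(\<Sum>i\<in>I. v i) = 1" using var by (simp add: v_def)
  \<comment> \<open>No single summand carries much of the total variance: this bound is uniform in
    \<open>i\<close>.\<close>
  have vle: "v i \<le> \<epsilon>\<^sup>2 + K" if "i \<in> I" for i
  proof -
    have "v i \<le> \<epsilon>\<^sup>2 + k i"
      unfolding v_def k_def using char_normal_bound(2)[OF rv mean mom \<delta> \<epsilon>] that by blast
    also have "k i \<le> K"
      unfolding K[symmetric] using that I k0 by (intro member_le_sum) auto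
    finally show ?thesis by simp
  qed
  have "complex_of_real (exp (- (t\<^sup>2 / 2))) = exp (\<Sum>i\<in>I. - (t\<^sup>2 * v i / 2))"
    by (simp add: sum_negf sum_divide_distrib[symmetric] sum_distrib_left[symmetric] v1)
  also have "\<dots> = (\<Prod>i\<in>I. complex_of_real (exp (- (t\<^sup>2 * v i / 2))))"
    using I by (simp add: exp_sum)
  finally have "cmod (char (distr M borel (\<lambda>x. \<Sum>i\<in>I. X i x)) t - exp (- (t\<^sup>2 / 2)))
     = cmod ((\<Prod>i\<in>I. char (distr M borel (X i)) t) - (\<Prod>i\<in>I. complex_of_real (exp (- (t\<^sup>2 * v i / 2)))))"
    by (simp add: char_distr_sum[OF indep])
  also have "\<dots> \<le> (\<Sum>i\<in>I. cmod (char (distr M borel (X i)) t - exp (- (t\<^sup>2 * v i / 2))))"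
  proof (rule norm_prod_diff)
    fix i assume "i \<in> I"
    then interpret D: real_distribution "distr M borel (X i)"
      by (intro real_distribution_distr rv)
    show "cmod (char (distr M borel (X i)) t) \<le> 1" by (rule D.cmod_char_le_1)
    show "cmod (complex_of_real (exp (- (t\<^sup>2 * v i / 2)))) \<le> 1"
      using v0[of i] by simp
  qed
  also have "\<dots> \<le> (\<Sum>i\<in>I. t\<^sup>2 / 6 * (\<epsilon> * \<bar>t\<bar> * v i + 6 * k i) + t ^ 4 / 8 * ((\<epsilon>\<^sup>2 + K) * v i))"
  proof (rule sum_mono)
    fix i assume i: "i \<in> I"
    have "cmod (char (distr M borel (X i)) t - exp (- (t\<^sup>2 * v i / 2)))
       \<le> t\<^sup>2 / 6 * (\<epsilon> * \<bar>t\<bar> * v i + 6 * k i) + (t\<^sup>2 * v i)\<^sup>2 / 8"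
      unfolding v_def k_def using char_normal_bound(1)[OF rv mean mom \<delta> \<epsilon>] i by blast
    also have "(t\<^sup>2 * v i)\<^sup>2 / 8 = t ^ 4 / 8 * (v i * v i)"
      by (simp add: power2_eq_square power4_eq_xxxx)
    \<comment> \<open>Only one of the two factors \<open>v i\<close> is replaced by the uniform
      bound; the other is kept so that summation over \<open>i\<close> yields the total variance
      1.\<close>
    also have "t ^ 4 / 8 * (v i * v i) \<le> t ^ 4 / 8 * ((\<epsilon>\<^sup>2 + K) * v i)"
      using vle[OF i] v0 by (intro mult_left_mono mult_right_mono) auto
    finally show "cmod (char (distr M borel (X i)) t - exp (- (t\<^sup>2 * v i / 2)))
       \<le> t\<^sup>2 / 6 * (\<epsilon> * \<bar>t\<bar> * v i + 6 * k i) + t ^ 4 / 8 * ((\<epsilon>\<^sup>2 + K) * v i)"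
      by simp
  qed
  also have "\<dots> = t\<^sup>2 / 6 * (\<epsilon> * \<bar>t\<bar> + 6 * K) + t ^ 4 / 8 * (\<epsilon>\<^sup>2 + K)"
    by (simp only: sum.distrib sum_distrib_left[symmetric] v1 K mult_1_right)
  finally show ?thesis .
qed

text \<open>Rows may live on different probability spaces, and only independence within a row is
  used. By Levy's continuity theorem it suffices that the characteristic functions converge
  pointwise; the bound for unit variance is applied to each row divided by
  \<open>s n\<close>.\<close>

theorem lyapunov_central_limit:
  fixes M :: "nat \<Rightarrow> 'a measure" and X :: "nat \<Rightarrow> 'i \<Rightarrow> 'a \<Rightarrow> real" and I :: "nat \<Rightarrow> 'i set"
  assumes M: "\<And>n. prob_space (M n)"
    and I: "\<And>n. finite (I n)"
    and indep: "\<And>n. prob_space.indep_vars (M n) (\<lambda>_. borel) (X n) (I n)"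
    and mean: "\<And>n i. i \<in> I n \<Longrightarrow> integral\<^sup>L (M n) (X n i) = 0"
    and mom: "\<And>n i. i \<in> I n \<Longrightarrow> integrable (M n) (\<lambda>x. \<bar>X n i x\<bar> powr (2 + \<delta>))"
    and \<delta>: "\<delta> > 0"
    and s: "\<And>n. s n > 0"
    and var: "\<And>n. (\<Sum>i\<in>I n. integral\<^sup>L (M n) (\<lambda>x. (X n i x)\<^sup>2)) = (s n)\<^sup>2"
    and lyapunov: "(\<lambda>n. (\<Sum>i\<in>I n. integral\<^sup>L (M n) (\<lambda>x. \<bar>X n i x\<bar> powr (2 + \<delta>))) / s n powr (2 + \<delta>))
      \<longlonglongrightarrow> 0"
  shows "weak_conv_m (\<lambda>n. distr (M n) borel (\<lambda>x. (\<Sum>i\<in>I n. X n i x) / s n)) std_normal_distribution"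
proof (rule levy_continuity)
  have rv: "X n i \<in> borel_measurable (M n)" if "i \<in> I n" for n i
    using indep[of n] that unfolding prob_space.indep_vars_def2[OF M] by simp
  show "real_distribution (distr (M n) borel (\<lambda>x. (\<Sum>i\<in>I n. X n i x) / s n))" for n
    using rv M by (intro prob_space.real_distribution_distr) (auto intro!: borel_measurable_divide borel_measurable_sum)
  show "real_distribution std_normal_distribution"
    by (rule real_dist_normal_dist)
  fix t :: real
  \<comment> \<open>The Lyapunov ratio, which is also the sum of the moments of order 2 + \<delta>
    of the rescaled row.\<close>
  define R where
    "R n = (\<Sum>i\<in>I n. integral\<^sup>L (M n) (\<lambda>x. \<bar>X n i x\<bar> powr (2 + \<delta>))) / s n powr (2 + \<delta>)" for n
  define D where
    "D n = cmod (char (distr (M n) borel (\<lambda>x. (\<Sum>i\<in>I n. X n i x) / s n)) t - exp (- (t\<^sup>2 / 2)))" for n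
  have bound: "D n \<le> t\<^sup>2 / 6 * (\<epsilon> * \<bar>t\<bar> + 6 * (R n / \<epsilon> powr \<delta>)) + t ^ 4 / 8 * (\<epsilon>\<^sup>2 + R n / \<epsilon> powr \<delta>)"
    if \<epsilon>: "\<epsilon> > 0" for n \<epsilon>
  proof -
    interpret prob_space "M n" by (rule M)
    have scaled: "\<bar>X n i x / s n\<bar> powr (2 + \<delta>) = \<bar>X n i x\<bar> powr (2 + \<delta>) / s n powr (2 + \<delta>)" for i x
      using s[of n] by (simp add: powr_divide)
    have Req: "R n = (\<Sum>i\<in>I n. expectation (\<lambda>x. \<bar>X n i x / s n\<bar> powr (2 + \<delta>)))"
      by (simp only: scaled R_def integral_divide_zero sum_divide_distrib)
    have "cmod (char (distr (M n) borel (\<lambda>x. \<Sum>i\<in>I n. X n i x / s n)) t - exp (- (t\<^sup>2 / 2)))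
       \<le> t\<^sup>2 / 6 * (\<epsilon> * \<bar>t\<bar> + 6 * (R n / \<epsilon> powr \<delta>)) + t ^ 4 / 8 * (\<epsilon>\<^sup>2 + R n / \<epsilon> powr \<delta>)"
      unfolding Req
    proof (rule char_sum_normal_bound[OF I _ _ _ _ \<delta> \<epsilon>])
      show "indep_vars (\<lambda>_. borel) (\<lambda>i x. X n i x / s n) (I n)"
        by (rule indep_vars_compose2[OF indep]) auto
      show "expectation (\<lambda>x. X n i x / s n) = 0" if "i \<in> I n" for i
        using mean[OF that] by simp
      show "integrable (M n) (\<lambda>x. \<bar>X n i x / s n\<bar> powr (2 + \<delta>))" if "i \<in> I n" for i
        using mom[OF that] by (simp only: scaled integrable_divide_zero)
      show "(\<Sum>i\<in>I n. expectation (\<lambda>x. (X n i x / s n)\<^sup>2)) = 1"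
        using s[of n] var[of n] by (simp add: power_divide sum_divide_distrib[symmetric])
    qed
    then show ?thesis by (simp add: D_def sum_divide_distrib)
  qed
  have "D \<longlonglongrightarrow> 0"
  proof (rule LIMSEQ_I, simp)
    fix r :: real assume "r > 0"
    \<comment> \<open>The part of the bound on \<open>D n\<close> that is free of
      \<open>R n\<close>. It is made small first, by choosing \<epsilon>; with \<epsilon> fixed, the
      rest is a constant times \<open>R n\<close> and tends to 0 in \<open>n\<close>.\<close>
    define B where "B \<epsilon> = t\<^sup>2 / 6 * (\<epsilon> * \<bar>t\<bar>) + t ^ 4 / 8 * \<epsilon>\<^sup>2" for \<epsilon>
    have "(B \<longlongrightarrow> B 0) (at_right 0)"
      unfolding B_def by (intro tendsto_intros)
    then have "eventually (\<lambda>\<epsilon>. B \<epsilon> < r / 2) (at_right 0)"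
      by (rule order_tendstoD(2)) (use \<open>r > 0\<close> in \<open>simp add: B_def\<close>)
    then have "eventually (\<lambda>\<epsilon>. 0 < \<epsilon> \<and> B \<epsilon> < r / 2) (at_right 0)"
      by (intro eventually_conj) (auto simp: eventually_at_right_less)
    then obtain \<epsilon> where \<epsilon>: "\<epsilon> > 0" "B \<epsilon> < r / 2"
      using eventually_happens'[OF trivial_limit_at_right_real] by blast
    have "(\<lambda>n. t\<^sup>2 / 6 * (6 * (R n / \<epsilon> powr \<delta>)) + t ^ 4 / 8 * (R n / \<epsilon> powr \<delta>))
       \<longlonglongrightarrow> t\<^sup>2 / 6 * (6 * (0 / \<epsilon> powr \<delta>)) + t ^ 4 / 8 * (0 / \<epsilon> powr \<delta>)"
      using lyapunov \<epsilon> unfolding R_def by (intro tendsto_intros) auto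
    then have "eventually (\<lambda>n. t\<^sup>2 / 6 * (6 * (R n / \<epsilon> powr \<delta>)) + t ^ 4 / 8 * (R n / \<epsilon> powr \<delta>) < r / 2) sequentially"
      by (rule order_tendstoD(2)) (use \<open>r > 0\<close> in simp)
    then obtain N where N: "\<And>n. n \<ge> N \<Longrightarrow>
        t\<^sup>2 / 6 * (6 * (R n / \<epsilon> powr \<delta>)) + t ^ 4 / 8 * (R n / \<epsilon> powr \<delta>) < r / 2"
      by (auto simp: eventually_sequentially)
    have "\<bar>D n\<bar> < r" if "n \<ge> N" for n
    proof -
      have "D n < r"
        using bound[OF \<epsilon>(1), of n] N[OF that] \<epsilon>(2) by (simp only: B_def distrib_left)
      then show ?thesis by (simp add: D_def)
    qed
    then show "\<exists>N. \<forall>n\<ge>N. \<bar>D n\<bar> < r" by blast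
  qed
  then show "(\<lambda>n. char (distr (M n) borel (\<lambda>x. (\<Sum>i\<in>I n. X n i x) / s n)) t)
      \<longlonglongrightarrow> char std_normal_distribution t"
    by (subst LIM_zero_iff[symmetric], subst tendsto_norm_zero_iff[symmetric])
      (simp add: char_std_normal_distribution D_def[abs_def])
qed

section \<open>Additivity of the variance\<close>

text \<open>The added variable is independent of the sum of the others and centred, so the cross
  term has expectation 0. Integrability is carried through the induction because splitting the
  integral of the square requires it.\<close>

lemma (in prob_space) expectation_square_sum_indep:
  fixes X :: "'i \<Rightarrow> 'a \<Rightarrow> real"
  assumes "finite I" and "indep_vars (\<lambda>_. borel) X I"
    and "\<And>i. i \<in> I \<Longrightarrow> expectation (X i) = 0"
    and "\<And>i. i \<in> I \<Longrightarrow> integrable M (\<lambda>x. (X i x)\<^sup>2)"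
  shows "integrable M (\<lambda>x. (\<Sum>i\<in>I. X i x)\<^sup>2) \<and>
    expectation (\<lambda>x. (\<Sum>i\<in>I. X i x)\<^sup>2) = (\<Sum>i\<in>I. expectation (\<lambda>x. (X i x)\<^sup>2))"
  using assms
proof (induction I)
  case (insert i I)
  define S where "S x = (\<Sum>j\<in>I. X j x)" for x
  have rv: "X j \<in> borel_measurable M" if "j \<in> insert i I" for j
    using insert.prems(1) that unfolding indep_vars_def2 by blast
  have int: "integrable M (X j)" if "j \<in> insert i I" for j
    using square_integrable_imp_integrable rv insert.prems(3) that by blast
  have "indep_vars (\<lambda>_. borel) X I"
    by (rule indep_vars_subset[OF insert.prems(1)]) auto
  then have IH: "integrable M (\<lambda>x. (S x)\<^sup>2)"
      "expectation (\<lambda>x. (S x)\<^sup>2) = (\<Sum>i\<in>I. expectation (\<lambda>x. (X i x)\<^sup>2))"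
    using insert.IH insert.prems(2,3) unfolding S_def by blast+
  have ind: "indep_var borel (X i) borel S"
    unfolding S_def[abs_def] by (rule indep_vars_sum[OF insert.hyps insert.prems(1)])
  have intS: "integrable M S"
    unfolding S_def[abs_def] using int by (intro Bochner_Integration.integrable_sum) blast
  have Xi: "integrable M (X i)" "integrable M (\<lambda>x. (X i x)\<^sup>2)"
    using int insert.prems(3) by blast+
  have cross: "integrable M (\<lambda>x. X i x * S x)" "expectation (\<lambda>x. X i x * S x) = 0"
    using indep_var_integrable[OF ind Xi(1) intS] indep_var_lebesgue_integral[OF ind Xi(1) intS]
      insert.prems(2)[of i] by simp_all
  have "(\<Sum>j\<in>insert i I. X j x)\<^sup>2 = (X i x)\<^sup>2 + (S x)\<^sup>2 + 2 * (X i x * S x)" for x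
    using insert.hyps by (simp add: S_def power2_sum mult.assoc)
  then show ?case
    using insert.hyps IH cross Xi(2) by simp
qed simp

subsection \<open>Lyapunov ratios of the levels\<close>

text \<open>Here \<open>m\<close>, \<open>v\<close>, \<open>k\<close> and \<open>S\<close> stand for \<open>M l\<close>, \<open>Var[G l]\<close>, \<open>E[\<bar>G l - E[G l]\<bar> powr (2 + \<delta>)]\<close> and \<open>Var[A]\<close>.\<close>

lemma level_ratio_bound:
  fixes m S v k x T :: real
  assumes \<beta>: "\<beta> > 1" and C: "C\<^sub>1 > 0" "C\<^sub>2 > 0" and \<delta>: "\<delta> > 0" and T: "T > 0"
    and m: "m \<ge> \<beta> powr (- q\<^sub>2 * x) * inverse (T\<^sup>2)"
    and v: "v \<ge> C\<^sub>1 * \<beta> powr (- q\<^sub>3 * x)"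
    and k: "k \<le> C\<^sub>2 * \<beta> powr (- \<tau> * x)"
    and S: "S \<ge> v / m"
  shows "k / m powr (1 + \<delta>) / S powr (1 + \<delta> / 2) \<le>
    C\<^sub>2 / C\<^sub>1 powr (1 + \<delta> / 2) *
      (T powr \<delta> * \<beta> powr (((1 + \<delta> / 2) * q\<^sub>3 + (\<delta> / 2) * q\<^sub>2 - \<tau>) * x))"
proof -
  \<comment> \<open>Half of the Lyapunov exponent 2 + \<delta>, since \<open>S\<close> is a variance
    and not a standard deviation.\<close>
  define a where "a = 1 + \<delta> / 2"
  define b where "b = \<beta> powr x"
  have a: "a > 0" using \<delta> by (simp add: a_def)
  have b: "b > 0" using \<beta> by (simp add: b_def)
  have bp: "\<beta> powr (y * x) = b powr y" for y
    by (simp add: b_def powr_powr mult.commute)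
  have m1: "m \<ge> b powr (- q\<^sub>2) * T powr (-2)"
    using m T by (simp only: bp powr_minus powr_numeral)
  then have m0: "m > 0"
    using b T by (smt (verit) mult_pos_pos powr_gt_zero)
  have "(C\<^sub>1 * b powr (- q\<^sub>3) / m) powr a \<le> S powr a"
  proof (intro powr_mono2)
    have "C\<^sub>1 * b powr (- q\<^sub>3) / m \<le> v / m"
      using v m0 by (intro divide_right_mono) (auto simp only: bp)
    then show "C\<^sub>1 * b powr (- q\<^sub>3) / m \<le> S" using S by simp
  qed (use a b C m0 in auto)
  moreover have "(C\<^sub>1 * b powr (- q\<^sub>3) / m) powr a = C\<^sub>1 powr a * b powr (- q\<^sub>3 * a) / m powr a"
    using C b m0 by (simp add: powr_divide powr_mult powr_powr)
  ultimately have D: "C\<^sub>1 powr a * b powr (- q\<^sub>3 * a) / m powr a \<le> S powr a" by simp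
  have "k / m powr (1 + \<delta>) / S powr a \<le> C\<^sub>2 * b powr (- \<tau>) / m powr (1 + \<delta>) / S powr a"
    using k by (intro divide_right_mono) (auto simp only: bp powr_ge_zero)
  also have "\<dots> \<le> C\<^sub>2 * b powr (- \<tau>) / m powr (1 + \<delta>) / (C\<^sub>1 powr a * b powr (- q\<^sub>3 * a) / m powr a)"
  proof (rule divide_left_mono[OF D])
    have "0 < C\<^sub>1 powr a * b powr (- q\<^sub>3 * a) / m powr a"
      using C b m0 by (intro divide_pos_pos mult_pos_pos) auto
    with D show "0 < S powr a * (C\<^sub>1 powr a * b powr (- q\<^sub>3 * a) / m powr a)"
      by (intro mult_pos_pos) auto
  qed (use C in auto)
  also have "\<dots> = C\<^sub>2 / C\<^sub>1 powr a * (b powr (- \<tau>) / b powr (- q\<^sub>3 * a)) * (m powr a / m powr (1 + \<delta>))"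
    by simp
  \<comment> \<open>The exponents of \<open>m\<close> combine to
    \<open>a - (1 + \<delta>) = - (\<delta> / 2)\<close>. As this is negative, the lower bound on
    \<open>m\<close> turns into an upper bound on the ratio.\<close>
  also have "\<dots> = C\<^sub>2 / C\<^sub>1 powr a * b powr (a * q\<^sub>3 - \<tau>) * m powr (- (\<delta> / 2))"
    by (simp add: powr_diff[symmetric] a_def algebra_simps)
  also have "\<dots> \<le> C\<^sub>2 / C\<^sub>1 powr a * b powr (a * q\<^sub>3 - \<tau>) * (b powr (- q\<^sub>2) * T powr (-2)) powr (- (\<delta> / 2))"
    using m1 b T \<delta> C by (intro mult_left_mono powr_mono2') auto
  also have "(b powr (- q\<^sub>2) * T powr (-2)) powr (- (\<delta> / 2)) = b powr (\<delta> / 2 * q\<^sub>2) * T powr \<delta>"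
    using b T by (simp add: powr_mult powr_powr mult.commute)
  also have "C\<^sub>2 / C\<^sub>1 powr a * b powr (a * q\<^sub>3 - \<tau>) * (b powr (\<delta> / 2 * q\<^sub>2) * T powr \<delta>)
      = C\<^sub>2 / C\<^sub>1 powr a * (T powr \<delta> * b powr (a * q\<^sub>3 + \<delta> / 2 * q\<^sub>2 - \<tau>))"
    by (simp add: powr_add[symmetric] powr_diff[symmetric] algebra_simps)
  finally show ?thesis by (simp only: bp a_def)
qed

text \<open>A geometric sum with ratio \<open>\<beta> powr p\<close>. For \<open>p < 0\<close> it
  stays bounded whatever \<open>L\<close> is. For \<open>p > 0\<close> its last term dominates, and
  the bound on \<open>L\<close> limits the growth of that term to order
  \<open>T powr (- c * p)\<close>, which \<open>T powr \<delta>\<close> beats exactly when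
  \<open>c < \<delta> / p\<close>.\<close>

lemma level_sum_tendsto_0:
  fixes L :: "real \<Rightarrow> nat"
  assumes \<beta>: "\<beta> > 1" and \<delta>: "\<delta> > 0"
    and L: "\<And>T. T > 0 \<Longrightarrow> real (L T) \<le> max 0 (c * ln (inverse T) / ln \<beta> + C)"
    and p: "p < 0 \<or> (p > 0 \<and> c < \<delta> / p)"
  shows "((\<lambda>T. \<Sum>l=0..L T. T powr \<delta> * \<beta> powr (p * real l)) \<longlongrightarrow> 0) (at_right 0)"
proof -
  define r where "r = \<beta> powr p"
  have r: "r > 0" using \<beta> by (simp add: r_def)
  have geo: "\<beta> powr (p * real l) = r ^ l" for l
    using \<beta> by (simp add: r_def powr_powr[symmetric] powr_realpow)
  have sum: "(\<Sum>l=0..n. T powr \<delta> * \<beta> powr (p * real l)) = T powr \<delta> * (\<Sum>l\<le>n. r ^ l)" for T n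
    by (simp add: geo sum_distrib_left atMost_atLeast0)
  have zero: "((\<lambda>T::real. T powr e) \<longlongrightarrow> 0) (at_right 0)" if "e > 0" for e
    using that by real_asymp
  have main: ?thesis if "(f \<longlongrightarrow> 0) (at_right 0)" and le: "\<And>T. T > 0 \<Longrightarrow> T powr \<delta> * (\<Sum>l\<le>L T. r ^ l) \<le> f T" for f
  proof (rule tendsto_sandwich[OF _ _ tendsto_const that(1)])
    show "eventually (\<lambda>T. 0 \<le> (\<Sum>l=0..L T. T powr \<delta> * \<beta> powr (p * real l))) (at_right 0)"
      by (intro always_eventually allI sum_nonneg) simp
    show "eventually (\<lambda>T. (\<Sum>l=0..L T. T powr \<delta> * \<beta> powr (p * real l)) \<le> f T) (at_right 0)"
      using le eventually_at_right_less[of 0] by (auto simp: sum elim!: eventually_mono)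
  qed
  show ?thesis
  proof (cases "p < 0")
    case True
    then have r1: "r < 1" using \<beta> by (simp add: r_def powr_less_one)
    show ?thesis
    proof (rule main)
      show "((\<lambda>T. T powr \<delta> * (1 / (1 - r))) \<longlongrightarrow> 0) (at_right 0)"
        using tendsto_mult_left_zero[OF zero[OF \<delta>]] .
      fix T :: real
      have "(\<Sum>l\<le>L T. r ^ l) \<le> 1 / (1 - r)"
        using r r1 by (simp add: sum_gp0 divide_right_mono)
      then show "T powr \<delta> * (\<Sum>l\<le>L T. r ^ l) \<le> T powr \<delta> * (1 / (1 - r))"
        by (intro mult_left_mono) auto
    qed
  next
    case False
    with p have p0: "p > 0" and cp: "\<delta> - c * p > 0" by (auto simp: field_simps)
    have r1: "r > 1" using \<beta> p0 by (simp add: r_def)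
    \<comment> \<open>A geometric sum with ratio \<open>r > 1\<close> is at most \<open>K\<close>
      times its last term.\<close>
    define K where "K = r / (r - 1)"
    have K: "K > 0" using r1 by (simp add: K_def)
    show ?thesis
    proof (rule main)
      have "((\<lambda>T. K * (T powr \<delta> + \<beta> powr (p * C) * T powr (\<delta> - c * p))) \<longlongrightarrow> K * (0 + \<beta> powr (p * C) * 0)) (at_right 0)"
        by (intro tendsto_intros zero \<delta> cp)
      then show "((\<lambda>T. K * (T powr \<delta> + \<beta> powr (p * C) * T powr (\<delta> - c * p))) \<longlongrightarrow> 0) (at_right 0)"
        by simp
      fix T :: real assume T: "T > 0"
      \<comment> \<open>The growing part of the bound on \<open>L T\<close>, a logarithm to base
        \<beta>, so that \<open>\<beta> powr Y\<close> is a pure power of \<open>T\<close>.\<close>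
      define Y where "Y = c * ln (inverse T) / ln \<beta>"
      have "\<beta> powr Y = T powr (- c)"
        using T \<beta> by (simp add: Y_def powr_def ln_inverse)
      then have "(\<beta> powr Y) powr p = T powr (- (c * p))"
        by (simp add: powr_powr)
      then have pw: "\<beta> powr (p * (Y + C)) = T powr (- (c * p)) * \<beta> powr (p * C)"
        by (simp add: distrib_left powr_add powr_powr mult.commute)
      have "r ^ L T = \<beta> powr (p * real (L T))" by (simp add: geo)
      also have "\<dots> \<le> \<beta> powr (p * max 0 (Y + C))"
        using L[OF T] \<beta> p0 unfolding Y_def by (intro powr_mono) auto
      \<comment> \<open>The summand 1 covers the case where the maximum is 0; it produces the
        separate term \<open>T powr \<delta>\<close> in the final bound.\<close>
      also have "\<dots> \<le> 1 + \<beta> powr (p * (Y + C))"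
        using \<beta> by (simp add: max_def)
      finally have rL: "r ^ L T \<le> 1 + T powr (- (c * p)) * \<beta> powr (p * C)" unfolding pw .
      have "(\<Sum>l\<le>L T. r ^ l) = (r * r ^ L T - 1) / (r - 1)"
        using r1 by (simp add: sum_gp0 field_simps)
      also have "\<dots> \<le> r * r ^ L T / (r - 1)"
        using r1 by (intro divide_right_mono) auto
      also have "\<dots> = K * r ^ L T" by (simp add: K_def)
      also have "\<dots> \<le> K * (1 + T powr (- (c * p)) * \<beta> powr (p * C))"
        using rL K by (intro mult_left_mono) auto
      finally have "T powr \<delta> * (\<Sum>l\<le>L T. r ^ l) \<le> T powr \<delta> * (K * (1 + T powr (- (c * p)) * \<beta> powr (p * C)))"
        by (intro mult_left_mono) auto
      also have "\<dots> = K * (T powr \<delta> + \<beta> powr (p * C) * T powr (\<delta> - c * p))"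
        using T by (simp add: algebra_simps powr_diff powr_minus divide_simps)
      finally show "T powr \<delta> * (\<Sum>l\<le>L T. r ^ l) \<le> K * (T powr \<delta> + \<beta> powr (p * C) * T powr (\<delta> - c * p))" .
    qed
  qed
qed

subsection \<open>The multilevel Monte Carlo estimator\<close>

text \<open>Equality in law moves every integral of a sample to an integral of \<open>G l\<close>
  over \<open>P\<close>. A level contributes \<open>M l\<close> equal terms, each carrying a power
  of \<open>1 / M l\<close>; the count cancels one factor, which turns the exponents 2 and 2 +
  \<delta> into 1 and 1 + \<delta>.\<close>

lemma
  fixes G :: "nat \<Rightarrow> 'a \<Rightarrow> real" and X :: "nat \<Rightarrow> nat \<Rightarrow> 'b \<Rightarrow> real"
  assumes P: "prob_space P" and Q: "prob_space Q"
    and G: "\<And>l. G l \<in> borel_measurable P"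
    and int: "\<And>l. integrable P (G l)"
    and mom: "\<And>l. integrable P (\<lambda>\<omega>. abs_deviation P (G l) \<omega> powr (2 + \<delta>))"
    and \<delta>: "\<delta> > 0"
    and M: "\<And>l. l \<le> L \<Longrightarrow> M l > 0"
    and samples: "mlmc_samples P G Q X L M"
  defines "I \<equiv> SIGMA l:{0..L}. {1..M l}"
    and "Z \<equiv> \<lambda>(l, m) \<omega>. (X l m \<omega> - integral\<^sup>L P (G l)) / real (M l)"
    and "A \<equiv> mlmc_estimator X L M"
  shows centered_samples_indep: "prob_space.indep_vars Q (\<lambda>_. borel) Z I"
    and centered_samples_mean: "\<And>i. i \<in> I \<Longrightarrow> integral\<^sup>L Q (Z i) = 0"
    and centered_samples_integrable: "\<And>i. i \<in> I \<Longrightarrow> integrable Q (\<lambda>\<omega>. \<bar>Z i \<omega>\<bar> powr (2 + \<delta>))"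
    and centered_samples_variance: "(\<Sum>i\<in>I. integral\<^sup>L Q (\<lambda>\<omega>. (Z i \<omega>)\<^sup>2))
      = (\<Sum>l=0..L. integral\<^sup>L P (\<lambda>\<omega>. (abs_deviation P (G l) \<omega>)\<^sup>2) / real (M l))"
    and centered_samples_moment: "(\<Sum>i\<in>I. integral\<^sup>L Q (\<lambda>\<omega>. \<bar>Z i \<omega>\<bar> powr (2 + \<delta>)))
      = (\<Sum>l=0..L. integral\<^sup>L P (\<lambda>\<omega>. abs_deviation P (G l) \<omega> powr (2 + \<delta>)) / real (M l) powr (1 + \<delta>))"
    and mlmc_estimator_minus_expectation: "\<And>\<omega>. A \<omega> - integral\<^sup>L Q A = (\<Sum>i\<in>I. Z i \<omega>)"
    and mlmc_estimator_variance: "integral\<^sup>L Q (\<lambda>\<omega>. (A \<omega> - integral\<^sup>L Q A)\<^sup>2)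
      = (\<Sum>l=0..L. integral\<^sup>L P (\<lambda>\<omega>. (abs_deviation P (G l) \<omega>)\<^sup>2) / real (M l))"
proof -
  interpret P: prob_space P by (rule P)
  interpret Q: prob_space Q by (rule Q)
  define \<mu> where "\<mu> l = integral\<^sup>L P (G l)" for l
  have finI: "finite I" by (simp add: I_def)
  have sumI: "(\<Sum>i\<in>I. f i) = (\<Sum>l=0..L. \<Sum>m=1..M l. f (l, m))" for f :: "nat \<times> nat \<Rightarrow> real"
    by (simp add: I_def sum.Sigma)
  have Zlm: "Z (l, m) \<omega> = (X l m \<omega> - \<mu> l) / real (M l)" for l m \<omega>
    by (simp add: Z_def \<mu>_def)
  have indX: "Q.indep_vars (\<lambda>_. borel) (\<lambda>(l, m). X l m) I"
    using samples by (simp add: mlmc_samples_def I_def)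
  have dist: "distr Q borel (X l m) = distr P borel (G l)" if "(l, m) \<in> I" for l m
    using samples that by (auto simp: mlmc_samples_def I_def)
  have X: "X l m \<in> borel_measurable Q" if "(l, m) \<in> I" for l m
    using indX that unfolding Q.indep_vars_def2 by fastforce
  \<comment> \<open>Both sides are statements about \<open>f\<close> under the common distribution
    on the real line.\<close>
  have transfer: "integrable Q (\<lambda>\<omega>. f (X l m \<omega>)) \<longleftrightarrow> integrable P (\<lambda>\<omega>. f (G l \<omega>))"
      "integral\<^sup>L Q (\<lambda>\<omega>. f (X l m \<omega>)) = integral\<^sup>L P (\<lambda>\<omega>. f (G l \<omega>))"
    if i: "(l, m) \<in> I" and f: "f \<in> borel_measurable borel" for l m and f :: "real \<Rightarrow> real"
    using integrable_distr_eq[OF X[OF i] f] integrable_distr_eq[OF G[of l] f]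
      integral_distr[OF X[OF i] f] integral_distr[OF G[of l] f] dist[OF i] by simp_all
  have Mpos: "real (M l) > 0" if "l \<in> {0..L}" for l
    using M[of l] that by simp

  \<comment> \<open>\<open>Z\<close> is written as an affine map, depending only on the level,
    applied to each sample; measurable maps of independent variables stay independent.\<close>
  have "Q.indep_vars (\<lambda>_. borel) (\<lambda>i \<omega>. (\<lambda>x. (x - \<mu> (fst i)) / real (M (fst i))) ((case i of (l, m) \<Rightarrow> X l m) \<omega>)) I"
    by (rule Q.indep_vars_compose2[OF indX]) auto
  also have "(\<lambda>i \<omega>. (\<lambda>x. (x - \<mu> (fst i)) / real (M (fst i))) ((case i of (l, m) \<Rightarrow> X l m) \<omega>)) = Z"
    by (auto simp: Z_def \<mu>_def fun_eq_iff)
  finally show indZ: "Q.indep_vars (\<lambda>_. borel) Z I" .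
  have Z: "Z i \<in> borel_measurable Q" if "i \<in> I" for i
    using indZ that unfolding Q.indep_vars_def2 by blast

  have intX: "integrable Q (X l m)" and EX: "integral\<^sup>L Q (X l m) = \<mu> l" if "(l, m) \<in> I" for l m
    using transfer[OF that, of "\<lambda>x. x"] int[of l] by (simp_all add: \<mu>_def)
  show meanZ: "integral\<^sup>L Q (Z i) = 0" if i: "i \<in> I" for i
  proof -
    obtain l m where lm: "i = (l, m)" by force
    then show ?thesis
      using intX EX i by (simp add: Zlm[abs_def] Q.prob_space)
  qed
  have scaled: "\<bar>Z (l, m) \<omega>\<bar> powr (2 + \<delta>) = \<bar>X l m \<omega> - \<mu> l\<bar> powr (2 + \<delta>) / real (M l) powr (2 + \<delta>)" for l m \<omega>
    by (simp add: Zlm powr_divide)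
  have intdev: "integrable Q (\<lambda>\<omega>. \<bar>X l m \<omega> - \<mu> l\<bar> powr (2 + \<delta>))"
    and Edev: "integral\<^sup>L Q (\<lambda>\<omega>. \<bar>X l m \<omega> - \<mu> l\<bar> powr (2 + \<delta>))
      = integral\<^sup>L P (\<lambda>\<omega>. abs_deviation P (G l) \<omega> powr (2 + \<delta>))" if "(l, m) \<in> I" for l m
    using transfer[OF that, of "\<lambda>x. \<bar>x - \<mu> l\<bar> powr (2 + \<delta>)"] mom[of l]
    by (simp_all add: abs_deviation_def \<mu>_def)
  show momZ: "integrable Q (\<lambda>\<omega>. \<bar>Z i \<omega>\<bar> powr (2 + \<delta>))" if i: "i \<in> I" for i
  proof -
    obtain l m where lm: "i = (l, m)" by force
    then show ?thesis
      using intdev i by (simp only: scaled integrable_divide_zero)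
  qed

  have EZ2: "integral\<^sup>L Q (\<lambda>\<omega>. (Z (l, m) \<omega>)\<^sup>2)
      = integral\<^sup>L P (\<lambda>\<omega>. (abs_deviation P (G l) \<omega>)\<^sup>2) / (real (M l))\<^sup>2" if "(l, m) \<in> I" for l m
    using transfer(2)[OF that, of "\<lambda>x. (x - \<mu> l)\<^sup>2"]
    by (simp add: Zlm power_divide abs_deviation_def \<mu>_def)
  have EZd: "integral\<^sup>L Q (\<lambda>\<omega>. \<bar>Z (l, m) \<omega>\<bar> powr (2 + \<delta>))
      = integral\<^sup>L P (\<lambda>\<omega>. abs_deviation P (G l) \<omega> powr (2 + \<delta>)) / real (M l) powr (2 + \<delta>)" if "(l, m) \<in> I" for l m
    by (simp only: scaled integral_divide_zero Edev[OF that])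

  have "(\<Sum>i\<in>I. integral\<^sup>L Q (\<lambda>\<omega>. (Z i \<omega>)\<^sup>2))
      = (\<Sum>l=0..L. \<Sum>m=1..M l. integral\<^sup>L P (\<lambda>\<omega>. (abs_deviation P (G l) \<omega>)\<^sup>2) / (real (M l))\<^sup>2)"
    unfolding sumI by (intro sum.cong refl EZ2) (auto simp: I_def)
  also have "\<dots> = (\<Sum>l=0..L. integral\<^sup>L P (\<lambda>\<omega>. (abs_deviation P (G l) \<omega>)\<^sup>2) / real (M l))"
    using Mpos by (intro sum.cong refl) (simp add: power2_eq_square)
  finally show var: "(\<Sum>i\<in>I. integral\<^sup>L Q (\<lambda>\<omega>. (Z i \<omega>)\<^sup>2))
      = (\<Sum>l=0..L. integral\<^sup>L P (\<lambda>\<omega>. (abs_deviation P (G l) \<omega>)\<^sup>2) / real (M l))" .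

  have "(\<Sum>i\<in>I. integral\<^sup>L Q (\<lambda>\<omega>. \<bar>Z i \<omega>\<bar> powr (2 + \<delta>)))
      = (\<Sum>l=0..L. \<Sum>m=1..M l. integral\<^sup>L P (\<lambda>\<omega>. abs_deviation P (G l) \<omega> powr (2 + \<delta>)) / real (M l) powr (2 + \<delta>))"
    unfolding sumI by (intro sum.cong refl EZd) (auto simp: I_def)
  also have "\<dots> = (\<Sum>l=0..L. integral\<^sup>L P (\<lambda>\<omega>. abs_deviation P (G l) \<omega> powr (2 + \<delta>)) / real (M l) powr (1 + \<delta>))"
  proof (intro sum.cong refl)
    fix l assume "l \<in> {0..L}"
    then have m: "real (M l) > 0" by (rule Mpos)
    \<comment> \<open>One factor is split off to cancel against the number of samples.\<close>
    have "real (M l) powr (2 + \<delta>) = real (M l) powr (1 + (1 + \<delta>))" by simp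
    also have "\<dots> = real (M l) * real (M l) powr (1 + \<delta>)"
      using m by (subst powr_add) simp
    finally show "(\<Sum>m=1..M l. integral\<^sup>L P (\<lambda>\<omega>. abs_deviation P (G l) \<omega> powr (2 + \<delta>)) / real (M l) powr (2 + \<delta>))
      = integral\<^sup>L P (\<lambda>\<omega>. abs_deviation P (G l) \<omega> powr (2 + \<delta>)) / real (M l) powr (1 + \<delta>)"
      using m by simp
  qed
  finally show "(\<Sum>i\<in>I. integral\<^sup>L Q (\<lambda>\<omega>. \<bar>Z i \<omega>\<bar> powr (2 + \<delta>)))
      = (\<Sum>l=0..L. integral\<^sup>L P (\<lambda>\<omega>. abs_deviation P (G l) \<omega> powr (2 + \<delta>)) / real (M l) powr (1 + \<delta>))" .

  have intX': "integrable Q (\<lambda>\<omega>. X l m \<omega> / real (M l))" if "l \<in> {0..L}" "m \<in> {1..M l}" for l m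
    using intX that by (simp add: I_def)
  have "integral\<^sup>L Q A = (\<Sum>l=0..L. integral\<^sup>L Q (\<lambda>\<omega>. \<Sum>m=1..M l. X l m \<omega> / real (M l)))"
    unfolding A_def mlmc_estimator_def
    by (intro Bochner_Integration.integral_sum Bochner_Integration.integrable_sum intX')
  also have "\<dots> = (\<Sum>l=0..L. \<Sum>m=1..M l. integral\<^sup>L Q (\<lambda>\<omega>. X l m \<omega> / real (M l)))"
    by (intro sum.cong refl Bochner_Integration.integral_sum intX')
  also have "\<dots> = (\<Sum>l=0..L. \<Sum>m=1..M l. \<mu> l / real (M l))"
    using EX by (intro sum.cong refl) (simp add: I_def)
  finally show AZ: "A \<omega> - integral\<^sup>L Q A = (\<Sum>i\<in>I. Z i \<omega>)" for \<omega>
    by (simp only: sumI Zlm diff_divide_distrib sum_subtractf A_def mlmc_estimator_def)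

  show "integral\<^sup>L Q (\<lambda>\<omega>. (A \<omega> - integral\<^sup>L Q A)\<^sup>2)
      = (\<Sum>l=0..L. integral\<^sup>L P (\<lambda>\<omega>. (abs_deviation P (G l) \<omega>)\<^sup>2) / real (M l))"
    unfolding AZ var[symmetric]
    using Q.expectation_square_sum_indep[OF finI indZ meanZ Q.integrable_square_of_powr[OF Z momZ \<delta>]]
    by blast
qed

text \<open>A law with a density has no atoms. Continuity matters because weak convergence gives
  convergence of distribution functions only at continuity points of the limit.\<close>

lemma isCont_cdf_std_normal: "isCont (cdf std_normal_distribution) z"
proof -
  interpret real_distribution std_normal_distribution by (rule real_dist_normal_dist)
  have "emeasure std_normal_distribution {z} = 0"
    by (subst emeasure_density) (auto simp: nn_integral_indicator_singleton)
  then show ?thesis by (simp add: isCont_cdf measure_def)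
qed

section \<open>Asymptotic normality of the estimator\<close>

theorem lemmaA1:
  fixes P :: "'a measure" and Q :: "'b measure"
    and G :: "nat \<Rightarrow> 'a \<Rightarrow> real"
    and X :: "real \<Rightarrow> nat \<Rightarrow> nat \<Rightarrow> 'b \<Rightarrow> real"
    and \<beta> C\<^sub>1 C\<^sub>2 q\<^sub>2 q\<^sub>3 \<delta> \<tau> c C p z :: real
    and H :: "nat \<Rightarrow> real"
    and L :: "real \<Rightarrow> nat"
    and M :: "real \<Rightarrow> nat \<Rightarrow> nat"
  assumes "prob_space P" and "prob_space Q"
    and "\<And>l. G l \<in> borel_measurable P"
    and "\<And>l. integrable P (G l)"
    and "\<And>l. integrable P (\<lambda>\<omega>. abs_deviation P (G l) \<omega> powr (2 + \<delta>))"
    and "\<beta> > 1" and "C\<^sub>1 > 0" and "C\<^sub>2 > 0" and "q\<^sub>3 > 0" and "\<delta> > 0" and "\<tau> > 0"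
    and "\<And>l. C\<^sub>1 * \<beta> powr (- q\<^sub>3 * real l)
              \<le> prob_space.expectation P (\<lambda>\<omega>. (abs_deviation P (G l) \<omega>)\<^sup>2)"
    and "\<And>l. prob_space.expectation P (\<lambda>\<omega>. abs_deviation P (G l) \<omega> powr (2 + \<delta>))
              \<le> C\<^sub>2 * \<beta> powr (- \<tau> * real l)"
    and "q\<^sub>2 > 0" and "\<And>l. H l > 0" and "c > 0"
    and "\<And>TOL. TOL > 0 \<Longrightarrow> real (L TOL) \<le> max 0 (c * ln (inverse TOL) / ln \<beta> + C)"
    and "\<And>TOL l. TOL > 0 \<Longrightarrow> l \<le> L TOL \<Longrightarrow> M TOL l > 0"
    and "\<And>TOL l. TOL > 0 \<Longrightarrow> l \<le> L TOL \<Longrightarrow>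
           real (M TOL l) \<ge>
             \<beta> powr (- q\<^sub>2 * real l) * inverse (TOL\<^sup>2) * inverse (H l) * (\<Sum>k=0..L TOL. H k)"
    and "\<And>TOL. TOL > 0 \<Longrightarrow> mlmc_samples P G Q (X TOL) (L TOL) (M TOL)"
    and "p = (1 + \<delta> / 2) * q\<^sub>3 + (\<delta> / 2) * q\<^sub>2 - \<tau>"
    and "p < 0 \<or> (p > 0 \<and> c < \<delta> / p)"
  shows "((\<lambda>TOL. let A = mlmc_estimator (X TOL) (L TOL) (M TOL)
                 in measure Q {\<omega> \<in> space Q.
                      (A \<omega> - prob_space.expectation Q A) / sqrt (prob_space.variance Q A) \<le> z})
          \<longlongrightarrow> cdf std_normal_distribution z) (at_right 0)"
proof -
  note P = assms(1) and Q = assms(2) and G = assms(3) and int = assms(4) and mom = assms(5)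
    and \<beta> = \<open>\<beta> > 1\<close> and C = \<open>C\<^sub>1 > 0\<close> \<open>C\<^sub>2 > 0\<close> and \<delta> = \<open>\<delta> > 0\<close>
    and lower = assms(12) and upper = assms(13) and H = assms(15)
    and L = assms(17) and M0 = assms(18) and M = assms(19) and samples = assms(20)
    and p = assms(21) and c = assms(22)
  interpret P: prob_space P by (rule P)
  interpret Q: prob_space Q by (rule Q)
  define v where "v l = integral\<^sup>L P (\<lambda>\<omega>. (abs_deviation P (G l) \<omega>)\<^sup>2)" for l
  define k where "k l = integral\<^sup>L P (\<lambda>\<omega>. abs_deviation P (G l) \<omega> powr (2 + \<delta>))" for l
  \<comment> \<open>The closed form of the variance of the estimator; the two are identified below
    for positive tolerances.\<close>
  define V where "V T = (\<Sum>l=0..L T. v l / real (M T l))" for T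
  define A where "A T = mlmc_estimator (X T) (L T) (M T)" for T
  define W where "W T \<omega> = (A T \<omega> - integral\<^sup>L Q (A T)) / sqrt (V T)" for T \<omega>
  define I where "I T = (SIGMA l:{0..L T}. {1..M T l})" for T
  define Z where "Z T = (\<lambda>(l, m) \<omega>. (X T l m \<omega> - integral\<^sup>L P (G l)) / real (M T l))" for T
  have v0: "v l > 0" for l
  proof -
    have "0 < C\<^sub>1 * \<beta> powr (- q\<^sub>3 * real l)" using C \<beta> by simp
    also have "\<dots> \<le> v l" unfolding v_def by (rule lower)
    finally show ?thesis .
  qed
  have Vl: "v l / real (M T l) \<le> V T" if "l \<in> {0..L T}" for l T
    unfolding V_def using that v0[THEN less_imp_le] by (intro member_le_sum) auto
  \<comment> \<open>Level 0 is always present and contributes a positive amount, so the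
    normalisation never divides by 0.\<close>
  have V0: "V T > 0" if "T > 0" for T
    using Vl[of 0 T] v0[of 0] M0[OF that, of 0] by (smt (verit) atLeastAtMost_iff divide_pos_pos le0 of_nat_0_less_iff)
  have variance: "integral\<^sup>L Q (\<lambda>\<omega>. (A T \<omega> - integral\<^sup>L Q (A T))\<^sup>2) = V T" if "T > 0" for T
    unfolding A_def V_def v_def
    by (rule mlmc_estimator_variance[OF P Q G int mom \<delta> M0[OF that] samples[OF that]])
  have WZ: "W T \<omega> = (\<Sum>i\<in>I T. Z T i \<omega>) / sqrt (V T)" if "T > 0" for T \<omega>
    unfolding W_def A_def I_def Z_def
    by (subst mlmc_estimator_minus_expectation[OF P Q G int mom \<delta> M0[OF that] samples[OF that]]) simp_all
  define R where "R T = (\<Sum>l=0..L T. k l / real (M T l) powr (1 + \<delta>)) / sqrt (V T) powr (2 + \<delta>)" for T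
  define B where "B = C\<^sub>2 / C\<^sub>1 powr (1 + \<delta> / 2)"
  have Rle: "R T \<le> B * (\<Sum>l=0..L T. T powr \<delta> * \<beta> powr (p * real l))" if T: "T > 0" for T
  proof -
    have "sqrt (V T) powr (2 + \<delta>) = V T powr (1 + \<delta> / 2)"
      using V0[OF T] by (simp add: powr_half_sqrt[symmetric] powr_powr add_divide_distrib)
    then have "R T = (\<Sum>l=0..L T. k l / real (M T l) powr (1 + \<delta>) / V T powr (1 + \<delta> / 2))"
      by (simp add: R_def sum_divide_distrib)
    also have "\<dots> \<le> (\<Sum>l=0..L T. B * (T powr \<delta> * \<beta> powr (p * real l)))"
      unfolding B_def p
    proof (intro sum_mono level_ratio_bound[OF \<beta> C \<delta> T])
      fix l assume l: "l \<in> {0..L T}"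
      have "inverse (H l) * H l \<le> inverse (H l) * (\<Sum>k=0..L T. H k)"
        using l H[THEN less_imp_le] by (intro mult_left_mono member_le_sum) auto
      then have "1 \<le> inverse (H l) * (\<Sum>k=0..L T. H k)"
        using H[of l] by simp
      then have "\<beta> powr (- q\<^sub>2 * real l) * inverse (T\<^sup>2) * 1
          \<le> \<beta> powr (- q\<^sub>2 * real l) * inverse (T\<^sup>2) * (inverse (H l) * (\<Sum>k=0..L T. H k))"
        by (intro mult_left_mono) auto
      also have "\<dots> \<le> real (M T l)"
        using M[OF T, of l] l by (simp add: mult.assoc)
      finally show "\<beta> powr (- q\<^sub>2 * real l) * inverse (T\<^sup>2) \<le> real (M T l)" by simp
      show "v l / real (M T l) \<le> V T" by (rule Vl[OF l])
      show "C\<^sub>1 * \<beta> powr (- q\<^sub>3 * real l) \<le> v l" unfolding v_def by (rule lower)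
      show "k l \<le> C\<^sub>2 * \<beta> powr (- \<tau> * real l)" unfolding k_def by (rule upper)
    qed
    finally show ?thesis by (simp add: sum_distrib_left)
  qed
  have R: "(R \<longlongrightarrow> 0) (at_right 0)"
  proof (rule tendsto_sandwich[OF _ _ tendsto_const])
    show "((\<lambda>T. B * (\<Sum>l=0..L T. T powr \<delta> * \<beta> powr (p * real l))) \<longlongrightarrow> 0) (at_right 0)"
      by (intro tendsto_mult_right_zero level_sum_tendsto_0[OF \<beta> \<delta> L c])
    show "eventually (\<lambda>T. 0 \<le> R T) (at_right 0)"
      by (intro always_eventually allI) (auto simp: R_def k_def intro!: divide_nonneg_nonneg sum_nonneg)
    show "eventually (\<lambda>T. R T \<le> B * (\<Sum>l=0..L T. T powr \<delta> * \<beta> powr (p * real l))) (at_right 0)"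
      using eventually_at_right_less[of 0] by eventually_elim (rule Rle)
  qed
  have Wmeas: "W T \<in> borel_measurable Q" if "T > 0" for T
  proof -
    have "Q.indep_vars (\<lambda>_. borel) (Z T) (I T)"
      unfolding I_def Z_def
      by (rule centered_samples_indep[OF P Q G int mom \<delta> M0[OF that] samples[OF that]])
    then have "Z T i \<in> borel_measurable Q" if "i \<in> I T" for i
      using that unfolding Q.indep_vars_def2 by blast
    then show ?thesis
      unfolding WZ[OF that, abs_def] by (intro borel_measurable_divide borel_measurable_sum) auto
  qed
  \<comment> \<open>The central limit theorem concerns sequences of rows, so the one-sided limit is
    tested along an arbitrary sequence of positive tolerances tending to 0.\<close>
  have "((\<lambda>T. cdf (distr Q borel (W T)) z) \<longlongrightarrow> cdf std_normal_distribution z) (at_right 0)"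
    unfolding tendsto_at_iff_sequentially
  proof (intro allI impI)
    fix T :: "nat \<Rightarrow> real"
    assume "\<forall>n. T n \<in> {0<..} - {0}" and lim: "T \<longlonglongrightarrow> 0"
    then have T: "T n > 0" for n by auto
    have "filterlim T (at_right 0) sequentially"
      using lim T T[THEN less_imp_neq, THEN not_sym] by (auto simp: filterlim_at intro!: always_eventually)
    then have RT: "(\<lambda>n. R (T n)) \<longlonglongrightarrow> 0"
      by (rule filterlim_compose[OF R])
    have "weak_conv_m (\<lambda>n. distr Q borel (\<lambda>\<omega>. (\<Sum>i\<in>I (T n). Z (T n) i \<omega>) / sqrt (V (T n))))
        std_normal_distribution"
    proof (rule lyapunov_central_limit[OF Q _ _ _ _ \<delta>])
      fix n
      note facts = P Q G int mom \<delta> M0[OF T] samples[OF T, of n]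
      show "finite (I (T n))" by (simp add: I_def)
      show "Q.indep_vars (\<lambda>_. borel) (Z (T n)) (I (T n))"
        unfolding I_def Z_def by (rule centered_samples_indep[OF facts])
      show "integral\<^sup>L Q (Z (T n) i) = 0" if "i \<in> I (T n)" for i
        unfolding Z_def by (rule centered_samples_mean[OF facts]) (use that in \<open>simp_all add: I_def\<close>)
      show "integrable Q (\<lambda>\<omega>. \<bar>Z (T n) i \<omega>\<bar> powr (2 + \<delta>))" if "i \<in> I (T n)" for i
        unfolding Z_def by (rule centered_samples_integrable[OF facts]) (use that in \<open>simp_all add: I_def\<close>)
      show "sqrt (V (T n)) > 0" using V0[OF T] by simp
      show "(\<Sum>i\<in>I (T n). integral\<^sup>L Q (\<lambda>\<omega>. (Z (T n) i \<omega>)\<^sup>2)) = (sqrt (V (T n)))\<^sup>2"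
        using centered_samples_variance[OF facts] V0[OF T, of n] by (simp add: I_def Z_def V_def v_def)
    next
      have "(\<Sum>i\<in>I (T n). integral\<^sup>L Q (\<lambda>\<omega>. \<bar>Z (T n) i \<omega>\<bar> powr (2 + \<delta>)))
          = (\<Sum>l=0..L (T n). k l / real (M (T n) l) powr (1 + \<delta>))" for n
        unfolding I_def Z_def k_def
        by (rule centered_samples_moment[OF P Q G int mom \<delta> M0[OF T] samples[OF T]])
      then show "(\<lambda>n. (\<Sum>i\<in>I (T n). integral\<^sup>L Q (\<lambda>\<omega>. \<bar>Z (T n) i \<omega>\<bar> powr (2 + \<delta>)))
          / sqrt (V (T n)) powr (2 + \<delta>)) \<longlonglongrightarrow> 0"
        using RT by (simp only: R_def)
    qed
    then have "weak_conv_m (\<lambda>n. distr Q borel (W (T n))) std_normal_distribution"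
      by (simp only: WZ[OF T, abs_def])
    then show "((\<lambda>T. cdf (distr Q borel (W T)) z) \<circ> T) \<longlonglongrightarrow> cdf std_normal_distribution z"
      using isCont_cdf_std_normal by (simp add: weak_conv_m_def weak_conv_def comp_def)
  qed
  \<comment> \<open>\<open>W\<close> normalises by \<open>V\<close>, the claim by the variance
    itself. The two probabilities agree for every positive tolerance, which is all that a limit from
    the right sees.\<close>
  then show ?thesis
    unfolding Let_def A_def[symmetric]
  proof (rule Lim_transform_eventually)
    have *: "cdf (distr Q borel (W T)) z = measure Q {\<omega> \<in> space Q. (A T \<omega> - integral\<^sup>L Q (A T))
        / sqrt (integral\<^sup>L Q (\<lambda>\<omega>. (A T \<omega> - integral\<^sup>L Q (A T))\<^sup>2)) \<le> z}" if "T > 0" for T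
    proof -
      have "W T -` {..z} \<inter> space Q = {\<omega> \<in> space Q. W T \<omega> \<le> z}" by auto
      then show ?thesis
        using Wmeas[OF that] by (simp add: cdf_def measure_distr W_def variance[OF that])
    qed
    show "eventually (\<lambda>T. cdf (distr Q borel (W T)) z = measure Q {\<omega> \<in> space Q. (A T \<omega> - integral\<^sup>L Q (A T))
        / sqrt (integral\<^sup>L Q (\<lambda>\<omega>. (A T \<omega> - integral\<^sup>L Q (A T))\<^sup>2)) \<le> z}) (at_right 0)"
      using eventually_at_right_less[of 0] by eventually_elim (rule *)
  qed
qed

end
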